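(* Let $C_1,\dots,C_M\subseteq\mathbb{R}^n$ be the hyperplanes $C_s=\{x:a_s^Tx=0\}$ with unit normal vectors $a_s$, $s\in[M]$. Given an initial point $y_0\in\mathbb{R}^n$ and a sampling scheme $p\in\mathcal{P}_{[M]}$, let $Y_0=y_0$ and let $Y_1,\dots,Y_k,\dots$ be the randomized Kaczmarz iterates defined by $$\mathbb{P}\left[\left.Y_{k+1}=\left(I-a_sa_s^T\right)Y_k\,\right|\,Y_k\right]=p(s),\qquad s\in[M].$$ Let $$\alpha=\max_{y\in S^{n-1}}y^T\sum_{s\in[M]}p(s)\left(I-a_sa_s^T\right)y.$$ Then, for all $k=0,1,2,\dotsc$, $$\mathbb{E}\left(\left.\Vert Y_{k+1}\Vert^2\,\right|\,y_0\right)\le\alpha^{k+1}\Vert y_0\Vert^2.$$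
   Context: $[M]=\{1,\dots,M\}$; $\mathcal{P}_{[M]}$ is the set of probability measures $p$ on $[M]$ with $\operatorname{supp}(p)=[M]$. $S^{n-1}$ is the unit sphere of $\mathbb{R}^n$ and $\Vert\cdot\Vert$ the Euclidean norm. The setting is that of the classical randomized Kaczmarz algorithm for a linear system $Ax=b$ with $M=m$ equations, where client $s$ holds the single equation $s$. The displayed transition rule means that, at each step, an index $s\in[M]$ is sampled with probability $p(s)$, independently of the past, and $Y_{k+1}=(I-a_sa_s^T)Y_k$. Standing assumption: the system is overdetermined and consistent with unique solution $x^*=0$, so $\bigcap_{s\in[M]}C_s=\{0\}$. *)

theory Defs
  imports "HOL-Probability.Probability"
begin

text \<open>The matrix \<open>I - a a\<^sup>T\<close>. The type constraint makes \<open>a\<close> a matrix with a single column;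
  \<open>columnvector\<close> is polymorphic in the number of copies of that column.\<close>

definition kaczmarz_matrix :: "real ^ 'n \<Rightarrow> real ^ 'n ^ 'n" where
  "kaczmarz_matrix a = mat 1 - (columnvector a :: real ^ 1 ^ 'n) ** rowvector a"

lemma kaczmarz_matrix_mult_vec:
  fixes a y :: "real ^ 'n"
  shows "kaczmarz_matrix a *v y = y - (a \<bullet> y) *\<^sub>R a"
proof -
  have "((columnvector a :: real ^ 1 ^ 'n) ** rowvector a) *v y = (a \<bullet> y) *\<^sub>R a"
    by (simp add: vec_eq_iff matrix_vector_mult_def matrix_matrix_mult_def columnvector_def
        rowvector_def inner_vec_def sum_distrib_left mult_ac)
  then show ?thesis
    by (simp add: kaczmarz_matrix_def matrix_vector_mult_diff_rdistrib)
qed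

text \<open>The sum runs over the index set \<open>[M] = {1..M}\<close>; \<open>GREATEST\<close> is the maximum of
  the values of the quadratic form on the unit sphere, which exists by the lemma below.\<close>

definition kaczmarz_rate :: "nat \<Rightarrow> nat pmf \<Rightarrow> (nat \<Rightarrow> real ^ 'n) \<Rightarrow> real" where
  "kaczmarz_rate M p a =
    (GREATEST r. \<exists>y\<in>sphere 0 1.
       r = y \<bullet> ((\<Sum>s=1..M. pmf p s *\<^sub>R kaczmarz_matrix (a s)) *v y))"

lemma kaczmarz_rate_is_maximum:
  fixes M :: nat and p :: "nat pmf" and a :: "nat \<Rightarrow> real ^ 'n"
  defines "q \<equiv> (\<lambda>y. y \<bullet> ((\<Sum>s=1..M. pmf p s *\<^sub>R kaczmarz_matrix (a s)) *v y))"
  shows "\<exists>y\<in>sphere 0 1. kaczmarz_rate M p a = q y"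
    and "\<And>y. y \<in> sphere 0 1 \<Longrightarrow> q y \<le> kaczmarz_rate M p a"
proof -
  have "sphere 0 1 \<noteq> ({} :: (real ^ 'n) set)"
    by simp
  moreover have "continuous_on (sphere 0 1) q"
    unfolding q_def
    by (intro continuous_on_inner continuous_on_id linear_continuous_on
        matrix_vector_mul_bounded_linear)
  ultimately obtain z where z: "z \<in> sphere 0 1" "\<And>y. y \<in> sphere 0 1 \<Longrightarrow> q y \<le> q z"
    using continuous_attains_sup[OF compact_sphere] by blast
  have "kaczmarz_rate M p a = q z"
    unfolding kaczmarz_rate_def
    by (rule Greatest_equality) (use z in \<open>auto simp: q_def\<close>)
  with z show "\<exists>y\<in>sphere 0 1. kaczmarz_rate M p a = q y"
    and "\<And>y. y \<in> sphere 0 1 \<Longrightarrow> q y \<le> kaczmarz_rate M p a"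
    by auto
qed

end

theory Submission
  imports Defs
begin

text \<open>For a unit vector \<open>a\<close> the matrix \<open>I - a a\<^sup>T\<close> is an orthogonal projection, so the energy
  left after projecting is itself a quadratic form:
  \<open>\<parallel>(I - a a\<^sup>T) y\<parallel>\<^sup>2 = y\<^sup>T (I - a a\<^sup>T) y\<close>. This is linear in the matrix, so averaging over a
  random index with distribution \<open>p\<close> replaces the matrix by its mean
  \<open>B = (\<Sum>s. p s (I - a\<^sub>s a\<^sub>s\<^sup>T))\<close>, and homogeneity turns the maximum \<open>\<alpha>\<close> over the unit sphere into
  \<open>y\<^sup>T B y \<le> \<alpha> \<parallel>y\<parallel>\<^sup>2\<close> for all \<open>y\<close>.

  The iterate \<open>Y\<^sub>k\<close> is a function of the first \<open>k\<close> sampled indices only, hence independent of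
  the next one (\<open>indep_var_present_past\<close>). The averaging may therefore be done with \<open>Y\<^sub>k\<close> held
  fixed, which yields \<open>E \<parallel>Y\<^bsub>k+1\<^esub>\<parallel>\<^sup>2 \<le> \<alpha> E \<parallel>Y\<^sub>k\<parallel>\<^sup>2\<close> (\<open>expectation_kaczmarz_step\<close>). As \<open>B\<close> is
  positive semidefinite, \<open>\<alpha>\<close> is nonnegative and the bound can be iterated.\<close>

text \<open>An orthogonal projection is symmetric and idempotent, so one of the two factors in the squared
  norm is absorbed. This turns the energy into an expression linear in the matrix.\<close>

lemma norm_kaczmarz_matrix_sq:
  fixes a y :: "real ^ 'n"
  assumes "norm a = 1"
  shows "(norm (kaczmarz_matrix a *v y))\<^sup>2 = y \<bullet> (kaczmarz_matrix a *v y)"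
proof -
  have "a \<bullet> a = 1"
    using assms by (simp add: dot_square_norm)
  then show ?thesis
    by (simp add: kaczmarz_matrix_mult_vec power2_norm_eq_inner inner_diff inner_commute)
qed

lemma norm_kaczmarz_matrix_le:
  fixes a y :: "real ^ 'n"
  assumes "norm a = 1"
  shows "norm (kaczmarz_matrix a *v y) \<le> norm y"
proof -
  \<comment> \<open>Pythagoras: the component of \<open>y\<close> along \<open>a\<close> is removed.\<close>
  have "(norm (kaczmarz_matrix a *v y))\<^sup>2 = (norm y)\<^sup>2 - (a \<bullet> y)\<^sup>2"
    unfolding norm_kaczmarz_matrix_sq[OF assms]
    by (simp add: kaczmarz_matrix_mult_vec inner_diff_right inner_commute power2_eq_square
        dot_square_norm)
  then have "(norm (kaczmarz_matrix a *v y))\<^sup>2 \<le> (norm y)\<^sup>2"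
    by simp
  then show ?thesis
    by (rule power2_le_imp_le) simp
qed

lemma sum_scaleR_matrix_vector_mult:
  fixes A :: "'i \<Rightarrow> real ^ 'n ^ 'm"
  shows "(\<Sum>s\<in>S. c s *\<^sub>R A s) *v y = (\<Sum>s\<in>S. c s *\<^sub>R (A s *v y))"
  by (induction S rule: infinite_finite_induct)
    (auto simp: matrix_vector_mult_add_rdistrib scaleR_matrix_vector_assoc)

text \<open>The form maximised in \<open>kaczmarz_rate\<close> is the expected energy after one step from a fixed
  point \<open>y\<close>; in particular it is nonnegative.\<close>

lemma mean_kaczmarz_form:
  fixes a :: "nat \<Rightarrow> real ^ 'n"
  assumes "\<And>s. s \<in> {1..M} \<Longrightarrow> norm (a s) = 1"
  shows "y \<bullet> ((\<Sum>s=1..M. pmf p s *\<^sub>R kaczmarz_matrix (a s)) *v y)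
    = (\<Sum>s=1..M. pmf p s * (norm (kaczmarz_matrix (a s) *v y))\<^sup>2)"
  using assms
  by (simp add: sum_scaleR_matrix_vector_mult inner_sum_right norm_kaczmarz_matrix_sq)

lemma kaczmarz_rate_nonneg:
  fixes a :: "nat \<Rightarrow> real ^ 'n"
  assumes "\<And>s. s \<in> {1..M} \<Longrightarrow> norm (a s) = 1"
  shows "0 \<le> kaczmarz_rate M p a"
proof -
  obtain y where "kaczmarz_rate M p a
      = y \<bullet> ((\<Sum>s=1..M. pmf p s *\<^sub>R kaczmarz_matrix (a s)) *v y)"
    using kaczmarz_rate_is_maximum(1)[of M p a] by blast
  also have "\<dots> \<ge> 0"
    by (subst mean_kaczmarz_form[OF assms]) (auto intro: sum_nonneg)
  finally show ?thesis .
qed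

text \<open>Both sides are homogeneous of degree two in \<open>y\<close>, so the maximum over the sphere controls
  every vector.\<close>

lemma mean_kaczmarz_norm_sq_le:
  fixes a :: "nat \<Rightarrow> real ^ 'n"
  assumes unit: "\<And>s. s \<in> {1..M} \<Longrightarrow> norm (a s) = 1"
  shows "(\<Sum>s=1..M. pmf p s * (norm (kaczmarz_matrix (a s) *v y))\<^sup>2)
    \<le> kaczmarz_rate M p a * (norm y)\<^sup>2"
proof (cases "y = 0")
  case False
  define u where "u = (1 / norm y) *\<^sub>R y"
  have u: "u \<in> sphere 0 1" and y: "y = norm y *\<^sub>R u"
    using False by (auto simp: u_def)
  have le: "(\<Sum>s=1..M. pmf p s * (norm (kaczmarz_matrix (a s) *v u))\<^sup>2)
      \<le> kaczmarz_rate M p a"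
    using kaczmarz_rate_is_maximum(2)[OF u]
    by (subst mean_kaczmarz_form[where a = a, OF unit, symmetric])
  have "norm (kaczmarz_matrix (a s) *v y) = norm y * norm (kaczmarz_matrix (a s) *v u)" for s
    by (subst y) (simp add: matrix_vector_mult_scaleR)
  then have "(\<Sum>s=1..M. pmf p s * (norm (kaczmarz_matrix (a s) *v y))\<^sup>2)
      = (\<Sum>s=1..M. pmf p s * (norm (kaczmarz_matrix (a s) *v u))\<^sup>2) * (norm y)\<^sup>2"
    by (simp add: power_mult_distrib sum_distrib_left mult_ac)
  also have "\<dots> \<le> kaczmarz_rate M p a * (norm y)\<^sup>2"
    using le by (rule mult_right_mono) simp
  finally show ?thesis .
qed simp

lemma borel_measurable_matrix_vector_mult_right [measurable]:
  fixes A :: "real ^ 'n ^ 'm"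
  shows "(*v) A \<in> borel_measurable borel"
  by (intro borel_measurable_continuous_onI linear_continuous_on
      matrix_vector_mul_bounded_linear)

text \<open>Both arguments of \<open>indep_var\<close> take values in the same type, so a vector cannot be declared
  independent of an index there. Stating independence after applying functions \<open>f\<close> and \<open>g\<close> with
  a common codomain avoids this.\<close>

lemma (in prob_space) indep_var_present_past:
  fixes idx :: "nat \<Rightarrow> 'a \<Rightarrow> 'i"
  assumes indep: "indep_vars (\<lambda>_. N) idx UNIV"
    and f: "f \<in> measurable N L"
    and g: "g \<in> measurable (PiM {..<k} (\<lambda>_. N)) L"
  shows "indep_var L (\<lambda>\<omega>. f (idx k \<omega>)) L (\<lambda>\<omega>. g (restrict (\<lambda>i. idx i \<omega>) {..<k}))"
proof -
  have "indep_var (PiM {k} (\<lambda>_. N)) (\<lambda>\<omega>. restrict (\<lambda>i. idx i \<omega>) {k})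
      (PiM {..<k} (\<lambda>_. N)) (\<lambda>\<omega>. restrict (\<lambda>i. idx i \<omega>) {..<k})"
    by (rule indep_var_restrict[OF indep]) auto
  moreover have "(\<lambda>x. f (x k)) \<in> measurable (PiM {k} (\<lambda>_. N)) L"
    by (rule measurable_compose[OF _ f]) (simp add: measurable_component_singleton)
  ultimately have "indep_var L ((\<lambda>x. f (x k)) \<circ> (\<lambda>\<omega>. restrict (\<lambda>i. idx i \<omega>) {k}))
      L (g \<circ> (\<lambda>\<omega>. restrict (\<lambda>i. idx i \<omega>) {..<k}))"
    using g by (rule indep_var_compose)
  then show ?thesis
    by (simp add: comp_def)
qed

text \<open>One step of the algorithm, started from a vector \<open>F\<close> determined by the earlier indices. The
  index takes finitely many values almost surely, so instead of conditioning on the past the integral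
  is split over these values \<open>s\<close>; independence factors each part into \<open>pmf p s\<close> times an
  integral over the past alone. Almost sure boundedness of the
  starting vector supplies all integrability.\<close>

lemma (in prob_space) expectation_kaczmarz_step:
  fixes a :: "nat \<Rightarrow> real ^ 'n" and F :: "(nat \<Rightarrow> nat) \<Rightarrow> real ^ 'n"
    and idx :: "nat \<Rightarrow> 'a \<Rightarrow> nat" and k :: nat
  defines "X \<equiv> \<lambda>\<omega>. F (restrict (\<lambda>i. idx i \<omega>) {..<k})"
  assumes unit: "\<And>s. s \<in> {1..N} \<Longrightarrow> norm (a s) = 1"
    and supp: "set_pmf p = {1..N}"
    and distr: "distr M (count_space UNIV) (idx k) = measure_pmf p"
    and indep: "indep_vars (\<lambda>_. count_space UNIV) idx UNIV"
    and F[measurable]: "F \<in> borel_measurable (PiM {..<k} (\<lambda>_. count_space UNIV))"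
    and bounded: "AE \<omega> in M. norm (X \<omega>) \<le> b"
  shows "expectation (\<lambda>\<omega>. (norm (kaczmarz_matrix (a (idx k \<omega>)) *v X \<omega>))\<^sup>2)
    \<le> kaczmarz_rate N p a * expectation (\<lambda>\<omega>. (norm (X \<omega>))\<^sup>2)"
proof -
  let ?A = "\<lambda>s. kaczmarz_matrix (a s)"
  let ?S = "idx k"
  have idx: "idx i \<in> measurable M (count_space UNIV)" for i
    using indep by (simp add: indep_vars_def)
  note S[measurable] = idx[of k]
  have X[measurable]: "X \<in> borel_measurable M"
    unfolding X_def by (rule measurable_compose[OF _ F]) (intro measurable_restrict idx)
  have AE_S: "AE \<omega> in M. ?S \<omega> \<in> {1..N}"
  proof -
    have "AE s in distr M (count_space UNIV) ?S. s \<in> {1..N}"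
      unfolding distr using supp by (simp add: AE_measure_pmf_iff)
    then show ?thesis
      by (subst (asm) AE_distr_iff) auto
  qed
  have int_X: "integrable M (\<lambda>\<omega>. (norm (X \<omega>))\<^sup>2)"
  proof (rule integrable_const_bound[where B = "b\<^sup>2"])
    show "AE \<omega> in M. norm ((norm (X \<omega>))\<^sup>2) \<le> b\<^sup>2"
      using bounded by eventually_elim (auto intro: power_mono)
  qed simp
  have int_AX: "integrable M (\<lambda>\<omega>. (norm (?A s *v X \<omega>))\<^sup>2)" if "s \<in> {1..N}" for s
    by (rule Bochner_Integration.integrable_bound[OF int_X])
      (auto intro!: AE_I2 power_mono norm_kaczmarz_matrix_le unit that)
  have [measurable]: "(\<lambda>\<omega>. indicator {s} (?S \<omega>) :: real) \<in> borel_measurable M" for s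
    by (rule measurable_compose[OF S]) simp
  have int_ind: "integrable M (\<lambda>\<omega>. indicator {s} (?S \<omega>) :: real)" for s
    by (rule integrable_const_bound[where B = 1]) (auto split: split_indicator)
  have E_ind: "expectation (\<lambda>\<omega>. indicator {s} (?S \<omega>)) = pmf p s" for s
  proof -
    have "expectation (\<lambda>\<omega>. indicator {s} (?S \<omega>) :: real)
        = (\<integral>t. indicator {s} t \<partial>distr M (count_space UNIV) ?S)"
      by (rule integral_distr[symmetric]) auto
    then show ?thesis
      by (simp add: distr measure_pmf_single)
  qed
  have indep_s: "indep_var borel (\<lambda>\<omega>. indicator {s} (?S \<omega>) :: real)
      borel (\<lambda>\<omega>. (norm (?A s *v X \<omega>))\<^sup>2)" for s
    unfolding X_def by (rule indep_var_present_past[OF indep]) (use F in measurable)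
  have "expectation (\<lambda>\<omega>. (norm (?A (?S \<omega>) *v X \<omega>))\<^sup>2)
      = expectation (\<lambda>\<omega>. \<Sum>s=1..N. indicator {s} (?S \<omega>) * (norm (?A s *v X \<omega>))\<^sup>2)"
  proof (rule integral_cong_AE)
    have "(\<lambda>\<omega>. ?A (?S \<omega>) *v X \<omega>) \<in> borel_measurable M"
      by (rule measurable_compose_countable[where g = ?S]) auto
    then show "(\<lambda>\<omega>. (norm (?A (?S \<omega>) *v X \<omega>))\<^sup>2) \<in> borel_measurable M"
      by simp
    show "AE \<omega> in M. (norm (?A (?S \<omega>) *v X \<omega>))\<^sup>2
        = (\<Sum>s=1..N. indicator {s} (?S \<omega>) * (norm (?A s *v X \<omega>))\<^sup>2)"
      using AE_S
    proof eventually_elim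
      case (elim \<omega>)
      have "(\<Sum>s=1..N. indicator {s} (?S \<omega>) * (norm (?A s *v X \<omega>))\<^sup>2)
          = (\<Sum>s=1..N. if ?S \<omega> = s then (norm (?A s *v X \<omega>))\<^sup>2 else 0)"
        by (intro sum.cong) (auto simp: indicator_def)
      with elim show ?case
        by (simp add: sum.delta')
    qed
  qed simp
  also have "\<dots> = (\<Sum>s=1..N. expectation (\<lambda>\<omega>. indicator {s} (?S \<omega>) * (norm (?A s *v X \<omega>))\<^sup>2))"
    by (intro Bochner_Integration.integral_sum indep_var_integrable indep_s int_ind int_AX)
  also have "\<dots> = (\<Sum>s=1..N. pmf p s * expectation (\<lambda>\<omega>. (norm (?A s *v X \<omega>))\<^sup>2))"
    by (intro sum.cong refl) (simp add: indep_var_lebesgue_integral indep_s int_ind int_AX E_ind)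
  also have "\<dots> = expectation (\<lambda>\<omega>. \<Sum>s=1..N. pmf p s * (norm (?A s *v X \<omega>))\<^sup>2)"
    using int_AX by (subst Bochner_Integration.integral_sum) auto
  also have "\<dots> \<le> expectation (\<lambda>\<omega>. kaczmarz_rate N p a * (norm (X \<omega>))\<^sup>2)"
    using int_AX int_X
    by (intro integral_mono mean_kaczmarz_norm_sq_le unit Bochner_Integration.integrable_sum) auto
  finally show ?thesis
    by simp
qed

text \<open>The iterates are separated from the probability space by taking the index sequence \<open>x\<close> as an
  argument: that step \<open>k\<close> sees only \<open>x 0, \<dots>, x (k - 1)\<close> is then a property of a deterministic
  function, and this is what independence of the next index rests on.\<close>

primrec kaczmarz_iterate ::
  "(nat \<Rightarrow> real ^ 'n) \<Rightarrow> real ^ 'n \<Rightarrow> (nat \<Rightarrow> nat) \<Rightarrow> nat \<Rightarrow> real ^ 'n" where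
  "kaczmarz_iterate a y0 x 0 = y0"
| "kaczmarz_iterate a y0 x (Suc k) = kaczmarz_matrix (a (x k)) *v kaczmarz_iterate a y0 x k"

lemma kaczmarz_iterate_restrict:
  "k \<le> j \<Longrightarrow> kaczmarz_iterate a y0 (restrict x {..<j}) k = kaczmarz_iterate a y0 x k"
  by (induction k) auto

text \<open>Separating \<open>k\<close> from \<open>j\<close> lets the induction run over a fixed product space.\<close>

lemma measurable_kaczmarz_iterate:
  "k \<le> j \<Longrightarrow> (\<lambda>x. kaczmarz_iterate a y0 x k)
    \<in> borel_measurable (PiM {..<j} (\<lambda>_. count_space UNIV))"
proof (induction k)
  case (Suc k)
  then have IH: "(\<lambda>x. kaczmarz_iterate a y0 x k)
      \<in> borel_measurable (PiM {..<j} (\<lambda>_. count_space UNIV))"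
    and "k \<in> {..<j}"
    by auto
  \<comment> \<open>The index has countably many values, so measurability need only be checked for each fixed value.\<close>
  show ?case
    unfolding kaczmarz_iterate.simps
    by (rule measurable_compose_countable[where g = "\<lambda>x. x k"])
      (rule measurable_compose[OF IH borel_measurable_matrix_vector_mult_right],
        rule measurable_component_singleton, fact)
qed simp

lemma norm_kaczmarz_iterate_le:
  assumes "\<And>i. norm (a (x i)) = 1"
  shows "norm (kaczmarz_iterate a y0 x k) \<le> norm y0"
  by (induction k) (auto intro: order_trans norm_kaczmarz_matrix_le assms)

theorem corollary2:
  fixes M :: nat
    and a :: "nat \<Rightarrow> real ^ 'n"
    and C :: "nat \<Rightarrow> (real ^ 'n) set"
    and p :: "nat pmf"
    and y0 :: "real ^ 'n"
    and P :: "'w measure"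
    and idx :: "nat \<Rightarrow> 'w \<Rightarrow> nat"
    and Y :: "nat \<Rightarrow> 'w \<Rightarrow> real ^ 'n"
    and \<alpha> :: real
  assumes unit: "\<And>s. s \<in> {1..M} \<Longrightarrow> norm (a s) = 1"
    and hyperplanes: "\<And>s. s \<in> {1..M} \<Longrightarrow> C s = {x. a s \<bullet> x = 0}"
    and unique_solution: "(\<Inter>s\<in>{1..M}. C s) = {0}"
    and supp: "set_pmf p = {1..M}"
    and prob_space: "prob_space P"
    and indep: "prob_space.indep_vars P (\<lambda>_. count_space UNIV) idx UNIV"
    and idx_distr: "\<And>k. distr P (count_space UNIV) (idx k) = measure_pmf p"
    and Y_0: "\<And>\<omega>. \<omega> \<in> space P \<Longrightarrow> Y 0 \<omega> = y0"
    and Y_Suc: "\<And>k \<omega>. \<omega> \<in> space P \<Longrightarrow>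
      Y (Suc k) \<omega> = kaczmarz_matrix (a (idx k \<omega>)) *v Y k \<omega>"
    and rate: "\<alpha> = kaczmarz_rate M p a"
  shows "\<forall>k. prob_space.expectation P (\<lambda>\<omega>. (norm (Y (k + 1) \<omega>))\<^sup>2)
      \<le> \<alpha> ^ (k + 1) * (norm y0)\<^sup>2"
proof -
  interpret prob_space P by (rule prob_space)
  let ?Z = "\<lambda>k \<omega>. kaczmarz_iterate a y0 (\<lambda>i. idx i \<omega>) k"
  have Y: "Y k \<omega> = ?Z k \<omega>" if "\<omega> \<in> space P" for k \<omega>
    using that by (induction k) (simp_all add: Y_0 Y_Suc)
  \<comment> \<open>Only \<open>a 1, \<dots>, a M\<close> are known to be unit vectors, so the iterates contract only along
    sequences of indices in \<open>{1..M}\<close>; almost every sequence is of this kind.\<close>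
  have "AE \<omega> in P. idx i \<omega> \<in> {1..M}" for i
  proof -
    have meas: "idx i \<in> measurable P (count_space UNIV)"
      using indep by (simp add: indep_vars_def)
    have "AE s in distr P (count_space UNIV) (idx i). s \<in> {1..M}"
      unfolding idx_distr using supp by (simp add: AE_measure_pmf_iff)
    then show ?thesis
      by (subst (asm) AE_distr_iff[OF meas]) auto
  qed
  then have "AE \<omega> in P. \<forall>i. idx i \<omega> \<in> {1..M}"
    by (simp add: AE_all_countable)
  then have bounded: "AE \<omega> in P. norm (?Z k \<omega>) \<le> norm y0" for k
    by eventually_elim (auto intro!: norm_kaczmarz_iterate_le unit)
  have decay: "expectation (\<lambda>\<omega>. (norm (?Z k \<omega>))\<^sup>2) \<le> \<alpha> ^ k * (norm y0)\<^sup>2" for k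
  proof (induction k)
    case (Suc k)
    have "expectation (\<lambda>\<omega>. (norm (?Z (Suc k) \<omega>))\<^sup>2)
        \<le> \<alpha> * expectation (\<lambda>\<omega>. (norm (?Z k \<omega>))\<^sup>2)"
      using expectation_kaczmarz_step[OF unit supp idx_distr indep
          measurable_kaczmarz_iterate[OF order_refl]] bounded[of k]
      by (simp add: kaczmarz_iterate_restrict rate)
    also have "\<dots> \<le> \<alpha> * (\<alpha> ^ k * (norm y0)\<^sup>2)"
      using Suc.IH kaczmarz_rate_nonneg[OF unit] by (intro mult_left_mono) (simp_all add: rate)
    finally show ?case
      by (simp add: mult_ac)
  qed (simp add: prob_space)
  show ?thesis
  proof
    fix k
    have "expectation (\<lambda>\<omega>. (norm (Y (k + 1) \<omega>))\<^sup>2)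
        = expectation (\<lambda>\<omega>. (norm (?Z (k + 1) \<omega>))\<^sup>2)"
      by (rule Bochner_Integration.integral_cong) (simp_all only: Y)
    also have "\<dots> \<le> \<alpha> ^ (k + 1) * (norm y0)\<^sup>2"
      by (rule decay)
    finally show "expectation (\<lambda>\<omega>. (norm (Y (k + 1) \<omega>))\<^sup>2) \<le> \<alpha> ^ (k + 1) * (norm y0)\<^sup>2" .
  qed
qed

end
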